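(* Let $r,d,M,N,K$ be positive integers with $d\le r$, let $Q\in\mathbb{S}^r$, $A_1,\dots,A_M\in\mathbb{S}^r$ and $b\in\mathbb{R}^M$, and consider the quadratically-constrained quadratic program $$\min_{X\in\mathbb{R}^{r\times d}}\ \langle Q, XX^{\mathsf T}\rangle\quad\text{s.t.}\quad \langle A_m, XX^{\mathsf T}\rangle=b_m,\ m\in[M]. \tag{P}$$ Let $r=\sum_{n=1}^N r_n$ with positive integers $r_n$, and partition the rows of $X$ into blocks $X_n\in\mathbb{R}^{r_n\times d}$, $n\in[N]$. Suppose that, with respect to this partition, (P) admits a factor graph model (in the sense defined in the context) with variables $X_1,\dots,X_N$, variable domains $\mathcal{X}_1,\dots,\mathcal{X}_N$, quadratic factors $\ell_k(X)=\langle Q_k,XX^{\mathsf T}\rangle$ with $Q_k\in\mathbb{S}^r$ ($k\in[K]$), and factor index sets $S_1,\dots,S_K\subseteq[N]$. Partition each $Q_k$ and each $A_m$ conformally into blocks $(Q_k)_{i,j},(A_m)_{i,j}\in\mathbb{R}^{r_i\times r_j}$, $i,j\in[N]$. Then the following hold. (1) Structure of the data of (P). For each $k\in[K]$: if $n\notin S_k$, then $(Q_k)_{n,i}=0$ for all $i\in[N]$ (so the $n$-th block row and block column of $Q_k$ vanish). The constraints of (P) are separable over the variables: the index set $[M]$ can be partitioned into subsets $L_1,\dots,L_N$ such that, for every $n\in[N]$ and $m\in L_n$, $(A_m)_{i,j}=0$ for all $(i,j)\neq(n,n)$. Consequently $$\ell_k(X)=\sum_{(i,j)\in S_k\times S_k}\langle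 (Q_k)_{i,j},X_iX_j^{\mathsf T}\rangle,\qquad k\in[K],$$ $$\mathcal{X}_n=\{X_n\in\mathbb{R}^{r_n\times d}:\langle (A_m)_{n,n},X_nX_n^{\mathsf T}\rangle=b_m\ \ \forall m\in L_n\},\qquad n\in[N].$$ (2) Lifted factor graph. Let $p$ be a positive integer and consider the rank-$p$ Burer-Monteiro factorization of the Shor relaxation of (P), $$\min_{Y\in\mathbb{R}^{r\times p}}\ \langle Q, YY^{\mathsf T}\rangle\quad\text{s.t.}\quad \langle A_m, YY^{\mathsf T}\rangle=b_m,\ m\in[M], \tag{BM}$$ with the rows of $Y$ partitioned conformally into blocks $Y_n\in\mathbb{R}^{r_n\times p}$, $n\in[N]$. Define, for $k\in[K]$ and $n\in[N]$, $$\bar\ell_k(Y_{S_k})=\sum_{(i,j)\in S_k\times S_k}\langle (Q_k)_{i,j},\,Y_iY_j^{\mathsf T}\rangle,$$ $$\mathcal{Y}_n=\{Y_n\in\mathbb{R}^{r_n\times p} : \langle (A_m)_{n,n},\,Y_nY_n^{\mathsf T}\rangle=b_m\ \ \forall m\in L_n\}.$$ Then (BM) admits a factor graph representation with variables $Y_1,\dots,Y_N$ having domains $\mathcal{Y}_1,\dots,\mathcal{Y}_N$, factors $\bar\ell_1,\dots,\bar\ell_K$, and edge set $\{(Y_n,\bar\ell_k): n\in S_k\}$; that is, its feasible set is $\mathcal{Y}_1\times\cdots\times\mathcal{Y}_N$ and its objective is $\langle Q,YY^{\mathsf T}\rangle=\sum_{k=1}^K\bar\ell_k(Y_{S_k})$.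 In particular its variables and factors are in one-to-one correspondence with those of the factor graph of (P), its variable-factor adjacency is identical, and its variable domains and factors are obtained from those of (P) by replacing $X_n\in\mathbb{R}^{r_n\times d}$ with $Y_n\in\mathbb{R}^{r_n\times p}$ in the formulas of part (1).
   Context: Notation: $[n]=\{1,\dots,n\}$; $\mathbb{S}^r$ is the space of real symmetric $r\times r$ matrices; $\langle A,B\rangle=\operatorname{tr}(A^{\mathsf T}B)$ is the Frobenius inner product. For a tuple $x=(x_1,\dots,x_N)$ and $S=\{i_1<\dots<i_k\}\subseteq[N]$, $x_S=(x_{i_1},\dots,x_{i_k})$. The Shor relaxation of the QCQP (P) is the semidefinite program obtained by replacing $XX^{\mathsf T}$ with an arbitrary symmetric positive semidefinite matrix $Z\in\mathbb{R}^{r\times r}$. Its rank-$p$ Burer-Monteiro factorization is obtained by substituting $Z=YY^{\mathsf T}$ with $Y\in\mathbb{R}^{r\times p}$. Factor graph model of a QCQP. Let $X\in\mathbb{R}^{r\times d}$ be partitioned into block rows $X_1,\dots,X_N$. The QCQP (P) admits a factor graph model with variables $X_1,\dots,X_N$, domains $\mathcal{X}_n\subseteq\mathbb{R}^{r_n\times d}$, factors $\ell_1,\dots,\ell_K$ and factor index sets $S_1,\dots,S_K\subseteq[N]$ if: (i) the objective decomposes as $\langle Q,XX^{\mathsf T}\rangle=\sum_{k=1}^K\ell_k(X)$, where each factor is a quadratic function $\ell_k(X)=\langle Q_k,XX^{\mathsf T}\rangle$ with $Q_k\in\mathbb{S}^r$, and $S_k$ is the set of indices of the variables among $X_1,\dots,X_N$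 that $\ell_k$ depends upon; (ii) the feasible set of (P) is the Cartesian product $\mathcal{X}_1\times\cdots\times\mathcal{X}_N$, i.e. each variable $X_n$ can be varied within its domain $\mathcal{X}_n$ independently of all the others. The associated factor graph is the bipartite graph with variable nodes $X_1,\dots,X_N$, factor nodes $\ell_1,\dots,\ell_K$, and an edge $(X_n,\ell_k)$ if and only if $n\in S_k$.
   Formalization: Condition (ii) is strengthened: each constraint function ⟨A_m,XXᵀ⟩ must depend on at most one block X_n, since a product feasible set alone does not imply separability; the formula for each individual domain of (P) is claimed only when (P) is feasible. *)

theory Defs
  imports Complex_Main "HOL-Library.FuncSet" "HOL-Library.Disjoint_Sets"
    "Jordan_Normal_Form.Matrix"
begin

(* All index ranges are 0-based: [N], [M], [K] become {..<N}, {..<M}, {..<K}, and the N row blocks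
   have sizes rs 0, ..., rs (N - 1). Families indexed by nat are only relevant on these ranges. *)

definition sym_mats :: "nat \<Rightarrow> real mat set" where
  "sym_mats r = {A \<in> carrier_mat r r. transpose_mat A = A}"

definition mat_trace :: "real mat \<Rightarrow> real" where
  "mat_trace A = (\<Sum>i<dim_row A. A $$ (i, i))"

definition frob :: "real mat \<Rightarrow> real mat \<Rightarrow> real" where
  "frob A B = mat_trace (transpose_mat A * B)"

definition quad_val :: "real mat \<Rightarrow> real mat \<Rightarrow> real" where
  "quad_val A X = frob A (X * transpose_mat X)"

(* The feasible set over matrices with c columns: (P) is c = d. The rank-p Burer-Monteiro
   factorization of the Shor relaxation is c = p, since Y * Y^T is always positive semidefinite. *)
definition qcqp_feasible ::
  "nat \<Rightarrow> nat \<Rightarrow> nat \<Rightarrow> (nat \<Rightarrow> real mat) \<Rightarrow> (nat \<Rightarrow> real) \<Rightarrow> real mat set" where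
  "qcqp_feasible r c M A b = {X \<in> carrier_mat r c. \<forall>m<M. quad_val (A m) X = b m}"

definition block_offset :: "(nat \<Rightarrow> nat) \<Rightarrow> nat \<Rightarrow> nat" where
  "block_offset rs n = (\<Sum>i<n. rs i)"

definition row_block :: "(nat \<Rightarrow> nat) \<Rightarrow> real mat \<Rightarrow> nat \<Rightarrow> real mat" where
  "row_block rs X n = mat (rs n) (dim_col X) (\<lambda>(s, t). X $$ (block_offset rs n + s, t))"

definition mat_block :: "(nat \<Rightarrow> nat) \<Rightarrow> real mat \<Rightarrow> nat \<Rightarrow> nat \<Rightarrow> real mat" where
  "mat_block rs A i j =
     mat (rs i) (rs j) (\<lambda>(s, t). A $$ (block_offset rs i + s, block_offset rs j + t))"

(* A matrix in R^(r x c) is identified with the tuple of its N row blocks. *)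
definition block_product ::
  "nat \<Rightarrow> (nat \<Rightarrow> nat) \<Rightarrow> nat \<Rightarrow> nat \<Rightarrow> (nat \<Rightarrow> real mat set) \<Rightarrow> real mat set" where
  "block_product N rs r c D = {X \<in> carrier_mat r c. \<forall>n<N. row_block rs X n \<in> D n}"

(* Indices of the block variables that f, as a function on all of R^(r x c), depends upon. *)
definition scope ::
  "nat \<Rightarrow> (nat \<Rightarrow> nat) \<Rightarrow> nat \<Rightarrow> nat \<Rightarrow> (real mat \<Rightarrow> real) \<Rightarrow> nat set" where
  "scope N rs r c f = {n. n < N \<and>
     (\<exists>X\<in>carrier_mat r c. \<exists>X'\<in>carrier_mat r c.
        (\<forall>i<N. i \<noteq> n \<longrightarrow> row_block rs X i = row_block rs X' i) \<and> f X \<noteq> f X')}"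

(* The QCQP over R^(r x c) with data Q, A, b admits a factor graph model with domains D, factors l k
   (given by the matrices Qf k) and factor index sets S k.
   The last conjunct is how "each variable can be varied independently of all the others" is read:
   no constraint function couples two variables. Equality of the feasible set with a product alone
   does not express this: for scalar x1, x2 the constraints x1^2 = 1, x2^2 = 1, x1^2 + x2^2 = 2 have
   the feasible set {-1, 1} x {-1, 1}, but the third one is not separable. Likewise x1^2 - x2^2 = 0,
   x1 * x2 = 0 has the feasible set {0} x {0}, but its rank-2 factorization is not a product. *)
definition factor_graph_model ::
  "nat \<Rightarrow> (nat \<Rightarrow> nat) \<Rightarrow> nat \<Rightarrow> nat \<Rightarrow> nat \<Rightarrow>
   real mat \<Rightarrow> (nat \<Rightarrow> real mat) \<Rightarrow> (nat \<Rightarrow> real) \<Rightarrow>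
   nat \<Rightarrow> (nat \<Rightarrow> real mat set) \<Rightarrow> (nat \<Rightarrow> real mat \<Rightarrow> real) \<Rightarrow> (nat \<Rightarrow> real mat) \<Rightarrow>
   (nat \<Rightarrow> nat set) \<Rightarrow> bool" where
  "factor_graph_model N rs r c M Q A b K D l Qf S \<longleftrightarrow>
     (\<forall>X\<in>carrier_mat r c. quad_val Q X = (\<Sum>k<K. l k X)) \<and>
     (\<forall>k<K. Qf k \<in> sym_mats r \<and> (\<forall>X\<in>carrier_mat r c. l k X = quad_val (Qf k) X)) \<and>
     (\<forall>k<K. S k = scope N rs r c (l k)) \<and>
     (\<forall>n<N. D n \<subseteq> carrier_mat (rs n) c) \<and>
     qcqp_feasible r c M A b = block_product N rs r c D \<and>
     (\<forall>m<M. card (scope N rs r c (quad_val (A m))) \<le> 1)"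

(* Edge set of the bipartite factor graph; (n, k) joins variable n and factor k. *)
definition factor_graph_edges ::
  "nat \<Rightarrow> (nat \<Rightarrow> nat) \<Rightarrow> nat \<Rightarrow> nat \<Rightarrow> nat \<Rightarrow> (nat \<Rightarrow> real mat \<Rightarrow> real) \<Rightarrow> (nat \<times> nat) set" where
  "factor_graph_edges N rs r c K l = {(n, k). n < N \<and> k < K \<and> n \<in> scope N rs r c (l k)}"

(* Parts of the partition may be empty (a variable may be unconstrained). *)
definition separating_partition ::
  "nat \<Rightarrow> (nat \<Rightarrow> nat) \<Rightarrow> nat \<Rightarrow> (nat \<Rightarrow> real mat) \<Rightarrow> (nat \<Rightarrow> nat set) \<Rightarrow> bool" where
  "separating_partition N rs M A L \<longleftrightarrow>
     (\<Union>n<N. L n) = {..<M} \<and> disjoint_family_on L {..<N} \<and>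
     (\<forall>n<N. \<forall>m\<in>L n. \<forall>i<N. \<forall>j<N.
        (i, j) \<noteq> (n, n) \<longrightarrow> mat_block rs (A m) i j = 0\<^sub>m (rs i) (rs j))"

(* A function of the subtuple of blocks with indices in S. *)
definition block_factor ::
  "(nat \<Rightarrow> nat) \<Rightarrow> real mat \<Rightarrow> nat set \<Rightarrow> (nat \<Rightarrow> real mat) \<Rightarrow> real" where
  "block_factor rs Qk S Xs =
     (\<Sum>(i, j)\<in>S \<times> S. frob (mat_block rs Qk i j) (Xs i * transpose_mat (Xs j)))"

definition block_domain ::
  "(nat \<Rightarrow> nat) \<Rightarrow> nat \<Rightarrow> (nat \<Rightarrow> real mat) \<Rightarrow> (nat \<Rightarrow> real) \<Rightarrow> (nat \<Rightarrow> nat set) \<Rightarrow>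
   nat \<Rightarrow> real mat set" where
  "block_domain rs c A b L n =
     {Xn \<in> carrier_mat (rs n) c.
        \<forall>m\<in>L n. frob (mat_block rs (A m) n n) (Xn * transpose_mat Xn) = b m}"

end

theory Submission
  imports Defs
begin

text \<open>
  The matrix of a quadratic form is recovered by polarization from its values on matrices with a
  single nonzero column. Hence, as soon as there is at least one column, the scope of
  \<open>X \<mapsto> \<langle>A, X X\<^sup>T\<rangle>\<close> is the set of indices of the nonzero block rows of \<open>A\<close>, and the identity
  \<open>\<langle>Q, X X\<^sup>T\<rangle> = \<Sum>\<^sub>k \<langle>Q\<^sub>k, X X\<^sup>T\<rangle>\<close> is the matrix identity \<open>Q = \<Sum>\<^sub>k Q\<^sub>k\<close>. Neither
  condition involves the number of columns, so the factor graph is the same for every rank.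
\<close>

section \<open>Row indices and block offsets\<close>

lemma block_offset_Suc: "block_offset rs (Suc n) = block_offset rs n + rs n"
  by (simp add: block_offset_def)

lemma block_offset_mono: "m \<le> n \<Longrightarrow> block_offset rs m \<le> block_offset rs n"
  unfolding block_offset_def by (rule sum_mono2) auto

lemma block_offset_add_less:
  assumes "n < N" "u < rs n"
  shows "block_offset rs n + u < block_offset rs N"
  using block_offset_mono[of "Suc n" N rs] assms by (simp add: block_offset_Suc)

lemma block_offset_add_inj:
  assumes "u < rs i" "v < rs j" "block_offset rs i + u = block_offset rs j + v"
  shows "i = j"
proof (rule linorder_cases[of i j])
  assume "i < j"
  from block_offset_add_less[of i j u rs, OF this assms(1)] assms(3) show ?thesis by simp
next
  assume "j < i"
  from block_offset_add_less[of j i v rs, OF this assms(2)] assms(3) show ?thesis by simp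
qed

text \<open>Translates a global row index into a block and a position inside it, so that entrywise
  arguments can be carried out block by block.\<close>

lemma less_block_offsetE:
  assumes "s < block_offset rs N"
  obtains n u where "n < N" "u < rs n" "s = block_offset rs n + u"
proof -
  have "\<exists>n<N. \<exists>u<rs n. s = block_offset rs n + u"
    using assms
  proof (induction N)
    case 0
    then show ?case by (simp add: block_offset_def)
  next
    case (Suc N)
    show ?case
    proof (cases "s < block_offset rs N")
      case True
      with Suc.IH show ?thesis using less_Suc_eq by blast
    next
      case False
      with Suc.prems have "s - block_offset rs N < rs N" "s = block_offset rs N + (s - block_offset rs N)"
        by (auto simp: block_offset_Suc)
      then show ?thesis by blast
    qed
  qed
  then show thesis using that by blast
qed

lemma sum_lessThan_block_offset:
  "(\<Sum>s<block_offset rs N. f s) = (\<Sum>n<N. \<Sum>u<rs n. f (block_offset rs n + u))"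
proof (induction N)
  case 0
  then show ?case by (simp add: block_offset_def)
next
  case (Suc N)
  have "(\<Sum>s<m + k. f s) = (\<Sum>s<m. f s) + (\<Sum>u<k. f (m + u))" for m k
    by (induction k) (simp_all add: add.assoc)
  with Suc show ?case by (simp add: block_offset_Suc)
qed

section \<open>Entrywise and blockwise expansion of quadratic forms\<close>

lemma frob_eq_sum:
  assumes "A \<in> carrier_mat m n" "B \<in> carrier_mat m n"
  shows "frob A B = (\<Sum>s<m. \<Sum>t<n. A $$ (s, t) * B $$ (s, t))"
proof -
  have "frob A B = (\<Sum>t<n. \<Sum>s<m. A $$ (s, t) * B $$ (s, t))"
    using assms by (simp add: frob_def mat_trace_def scalar_prod_def atLeast0LessThan)
  then show ?thesis by (simp add: sum.swap[of _ "{..<n}"])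
qed

lemma frob_mult_transpose:
  assumes "A \<in> carrier_mat m n" "X \<in> carrier_mat m c" "Y \<in> carrier_mat n c"
  shows "frob A (X * transpose_mat Y) =
    (\<Sum>s<m. \<Sum>t<n. A $$ (s, t) * (\<Sum>u<c. X $$ (s, u) * Y $$ (t, u)))"
proof -
  have XY: "X * transpose_mat Y \<in> carrier_mat m n" using assms by simp
  show ?thesis
    unfolding frob_eq_sum[OF assms(1) XY]
    using assms by (intro sum.cong refl) (simp add: scalar_prod_def atLeast0LessThan)
qed

lemma quad_val_eq_sum:
  assumes "A \<in> carrier_mat r r" "X \<in> carrier_mat r c"
  shows "quad_val A X = (\<Sum>s<r. \<Sum>t<r. A $$ (s, t) * (\<Sum>u<c. X $$ (s, u) * X $$ (t, u)))"
  unfolding quad_val_def using assms by (intro frob_mult_transpose)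

lemma row_block_carrier [simp]: "X \<in> carrier_mat r c \<Longrightarrow> row_block rs X n \<in> carrier_mat (rs n) c"
  by (simp add: row_block_def)

lemma row_block_eqD:
  assumes "row_block rs X n = row_block rs Y n" "X \<in> carrier_mat r c" "Y \<in> carrier_mat r c"
    "u < rs n" "v < c"
  shows "X $$ (block_offset rs n + u, v) = Y $$ (block_offset rs n + u, v)"
proof -
  have "row_block rs X n $$ (u, v) = row_block rs Y n $$ (u, v)" using assms(1) by simp
  then show ?thesis using assms(2-) by (simp add: row_block_def)
qed

lemma mat_block_zeroD:
  assumes "mat_block rs A i j = 0\<^sub>m (rs i) (rs j)" "u < rs i" "v < rs j"
  shows "A $$ (block_offset rs i + u, block_offset rs j + v) = 0"
proof -
  have "mat_block rs A i j $$ (u, v) = 0" using assms by simp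
  then show ?thesis using assms(2-) by (simp add: mat_block_def)
qed

lemma quad_val_eq_sum_blocks:
  assumes A: "A \<in> carrier_mat r r" and X: "X \<in> carrier_mat r c" and r: "r = block_offset rs N"
  shows "quad_val A X =
    (\<Sum>i<N. \<Sum>j<N. frob (mat_block rs A i j) (row_block rs X i * transpose_mat (row_block rs X j)))"
proof -
  let ?g = "\<lambda>s t. A $$ (s, t) * (\<Sum>u<c. X $$ (s, u) * X $$ (t, u))"
  have "quad_val A X = (\<Sum>s<r. \<Sum>t<r. ?g s t)"
    by (rule quad_val_eq_sum[OF A X])
  also have "\<dots> = (\<Sum>i<N. \<Sum>u<rs i. \<Sum>j<N. \<Sum>v<rs j. ?g (block_offset rs i + u) (block_offset rs j + v))"
    by (simp only: r sum_lessThan_block_offset)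
  also have "\<dots> = (\<Sum>i<N. \<Sum>j<N. \<Sum>u<rs i. \<Sum>v<rs j. ?g (block_offset rs i + u) (block_offset rs j + v))"
    by (rule sum.cong[OF refl], rule sum.swap)
  also have "\<dots> = (\<Sum>i<N. \<Sum>j<N. frob (mat_block rs A i j) (row_block rs X i * transpose_mat (row_block rs X j)))"
  proof (intro sum.cong refl)
    fix i j
    have B: "mat_block rs A i j \<in> carrier_mat (rs i) (rs j)" by (simp add: mat_block_def)
    show "(\<Sum>u<rs i. \<Sum>v<rs j. ?g (block_offset rs i + u) (block_offset rs j + v)) =
        frob (mat_block rs A i j) (row_block rs X i * transpose_mat (row_block rs X j))"
      unfolding frob_mult_transpose[OF B row_block_carrier[OF X, of rs i] row_block_carrier[OF X, of rs j]]
      using X by (intro sum.cong refl) (simp add: mat_block_def row_block_def)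
  qed
  finally show ?thesis .
qed

text \<open>In the full block expansion every term outside \<open>S \<times> S\<close> has a zero
  coefficient block. The \<open>restrict\<close> makes the right-hand side a function of the
  subtuple of blocks in \<open>S\<close> only.\<close>

lemma quad_val_eq_block_factor:
  assumes A: "A \<in> carrier_mat r r" and X: "X \<in> carrier_mat r c" and r: "r = block_offset rs N"
    and S: "S \<subseteq> {..<N}"
    and 0: "\<And>i j. i < N \<Longrightarrow> j < N \<Longrightarrow> i \<notin> S \<or> j \<notin> S \<Longrightarrow> mat_block rs A i j = 0\<^sub>m (rs i) (rs j)"
  shows "quad_val A X = block_factor rs A S (restrict (row_block rs X) S)"
proof -
  let ?f = "\<lambda>i j. frob (mat_block rs A i j) (row_block rs X i * transpose_mat (row_block rs X j))"
  have z: "?f i j = 0" if "i < N" "j < N" "i \<notin> S \<or> j \<notin> S" for i j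
    unfolding 0[OF that] using X
    by (subst frob_mult_transpose[of _ "rs i" "rs j" _ c]) (auto intro!: sum.neutral)
  have "quad_val A X = (\<Sum>(i, j)\<in>{..<N} \<times> {..<N}. ?f i j)"
    by (simp add: quad_val_eq_sum_blocks[OF A X r] sum.cartesian_product)
  also have "\<dots> = (\<Sum>(i, j)\<in>S \<times> S. ?f i j)"
    using S z by (intro sum.mono_neutral_right) auto
  also have "\<dots> = block_factor rs A S (restrict (row_block rs X) S)"
    unfolding block_factor_def by (intro sum.cong) auto
  finally show ?thesis .
qed

section \<open>Polarization\<close>

text \<open>With \<open>x\<close> in column 0 and zeros elsewhere, \<open>X X\<^sup>T\<close>
  becomes the rank-one matrix \<open>x x\<^sup>T\<close> for every positive number of columns
  \<open>c\<close>.\<close>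

definition single_column :: "nat \<Rightarrow> nat \<Rightarrow> (nat \<Rightarrow> real) \<Rightarrow> real mat" where
  "single_column r c x = mat r c (\<lambda>(s, u). if u = 0 then x s else 0)"

lemma single_column_carrier [simp]: "single_column r c x \<in> carrier_mat r c"
  by (simp add: single_column_def)

lemma quad_val_single_column:
  assumes "A \<in> carrier_mat r r" "0 < c"
  shows "quad_val A (single_column r c x) = (\<Sum>s<r. \<Sum>t<r. A $$ (s, t) * (x s * x t))"
proof -
  have "(\<Sum>u<c. single_column r c x $$ (s, u) * single_column r c x $$ (t, u)) = x s * x t"
    if "s < r" "t < r" for s t
  proof -
    have "(\<Sum>u<c. single_column r c x $$ (s, u) * single_column r c x $$ (t, u)) =
        (\<Sum>u<c. if u = 0 then x s * x t else 0)"
      using that by (intro sum.cong) (auto simp: single_column_def)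
    then show ?thesis using assms(2) by simp
  qed
  then show ?thesis by (simp add: quad_val_eq_sum[OF assms(1) single_column_carrier])
qed

text \<open>With \<open>q\<close> the quadratic form and \<open>e_s\<close> the unit vectors,
  \<open>q (e_s + e_t) - q e_s - q e_t\<close> equals \<open>A_st + A_ts\<close>, and symmetry
  merges the two terms. The case \<open>s = t\<close> is included: it reads
  \<open>4 A_ss - 2 A_ss\<close>.\<close>

lemma polarization:
  assumes A: "A \<in> sym_mats r" and "0 < c" "s < r" "t < r"
  shows "2 * A $$ (s, t) =
    quad_val A (single_column r c (\<lambda>i. of_bool (i = s) + of_bool (i = t)))
    - quad_val A (single_column r c (\<lambda>i. of_bool (i = s)))
    - quad_val A (single_column r c (\<lambda>i. of_bool (i = t)))"
proof -
  have C: "A \<in> carrier_mat r r" and T: "transpose_mat A = A"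
    using A by (auto simp: sym_mats_def)
  have "transpose_mat A $$ (s, t) = A $$ (t, s)" using C assms(3,4) by simp
  then have sym: "A $$ (t, s) = A $$ (s, t)" by (simp add: T)
  \<comment> \<open>Pairing with \<open>e_a e_b\<^sup>T\<close> extracts one entry. Expanding the
    product for \<open>e_s + e_t\<close> gives four such pairings.\<close>
  have e: "(\<Sum>i<r. \<Sum>j<r. A $$ (i, j) * (of_bool (i = a) * of_bool (j = b))) = A $$ (a, b)"
    if "a < r" "b < r" for a b
  proof -
    have "(\<Sum>j<r. A $$ (i, j) * (of_bool (i = a) * of_bool (j = b))) = (if i = a then A $$ (i, b) else 0)" for i
    proof -
      have "(\<Sum>j<r. A $$ (i, j) * (of_bool (i = a) * of_bool (j = b))) =
          (\<Sum>j<r. if j = b then (if i = a then A $$ (i, b) else 0) else 0)"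
        by (intro sum.cong) auto
      then show ?thesis using that by simp
    qed
    then show ?thesis using that by simp
  qed
  show ?thesis
    using sym assms(3,4)
    by (simp only: quad_val_single_column[OF C assms(2)] ring_distribs sum.distrib e)
qed

section \<open>Scopes of quadratic forms\<close>

text \<open>If block row \<open>n\<close> vanishes, symmetry kills block column \<open>n\<close>
  too, and the remaining terms never see block \<open>n\<close>. Conversely, if block
  \<open>n\<close> has no influence, polarization with a unit vector in block \<open>n\<close>
  forces the entries of that block row to be zero. The criterion is free of \<open>c\<close>, which
  is what allows passing between \<open>d\<close> and \<open>p\<close> columns.\<close>

lemma mem_scope_quad_val_iff:
  assumes A: "A \<in> sym_mats r" and c: "0 < c" and r: "r = block_offset rs N" and n: "n < N"
  shows "n \<in> scope N rs r c (quad_val A) \<longleftrightarrow>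
    (\<exists>i<N. mat_block rs A n i \<noteq> 0\<^sub>m (rs n) (rs i))"
proof (intro iffI; rule ccontr)
  assume mem: "n \<in> scope N rs r c (quad_val A)"
    and "\<not> (\<exists>i<N. mat_block rs A n i \<noteq> 0\<^sub>m (rs n) (rs i))"
  then have 0: "mat_block rs A n i = 0\<^sub>m (rs n) (rs i)" if "i < N" for i using that by blast
  have C: "A \<in> carrier_mat r r" and T: "transpose_mat A = A"
    using A by (auto simp: sym_mats_def)
  have sym: "A $$ (t, s) = A $$ (s, t)" if "s < r" "t < r" for s t
  proof -
    have "transpose_mat A $$ (s, t) = A $$ (t, s)" using C that by simp
    then show ?thesis by (simp add: T)
  qed
  obtain X Y where X: "X \<in> carrier_mat r c" and Y: "Y \<in> carrier_mat r c"
    and XY: "\<And>i. i < N \<Longrightarrow> i \<noteq> n \<Longrightarrow> row_block rs X i = row_block rs Y i"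
    and ne: "quad_val A X \<noteq> quad_val A Y"
    using mem by (auto simp: scope_def)
  have "A $$ (s, t) * (\<Sum>u<c. X $$ (s, u) * X $$ (t, u)) =
      A $$ (s, t) * (\<Sum>u<c. Y $$ (s, u) * Y $$ (t, u))" if st: "s < r" "t < r" for s t
  proof -
    obtain i u where i: "i < N" "u < rs i" "s = block_offset rs i + u"
      using st(1) r less_block_offsetE by blast
    obtain j v where j: "j < N" "v < rs j" "t = block_offset rs j + v"
      using st(2) r less_block_offsetE by blast
    consider "i = n" | "j = n" | "i \<noteq> n" "j \<noteq> n" by blast
    then show ?thesis
    proof cases
      case 1
      then have "A $$ (s, t) = 0" using mat_block_zeroD[OF 0[OF j(1)]] i j by simp
      then show ?thesis by simp
    next
      case 2
      \<comment> \<open>Only block row \<open>n\<close> is known to vanish; the entry in block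
        column \<open>n\<close> is reached through its transpose.\<close>
      then have "A $$ (t, s) = 0" using mat_block_zeroD[OF 0[OF i(1)]] i j by simp
      then show ?thesis using sym st by simp
    next
      case 3
      have "X $$ (s, w) = Y $$ (s, w)" "X $$ (t, w) = Y $$ (t, w)" if "w < c" for w
        using row_block_eqD[OF XY[OF i(1) 3(1)] X Y i(2) that]
          row_block_eqD[OF XY[OF j(1) 3(2)] X Y j(2) that] i j by simp_all
      then show ?thesis by simp
    qed
  qed
  then have "quad_val A X = quad_val A Y"
    unfolding quad_val_eq_sum[OF C X] quad_val_eq_sum[OF C Y] by (intro sum.cong refl) simp
  with ne show False ..
next
  assume "\<exists>i<N. mat_block rs A n i \<noteq> 0\<^sub>m (rs n) (rs i)"
    and notin: "n \<notin> scope N rs r c (quad_val A)"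
  then obtain i where i: "i < N" "mat_block rs A n i \<noteq> 0\<^sub>m (rs n) (rs i)" by blast
  have inv: "quad_val A X = quad_val A Y"
    if "X \<in> carrier_mat r c" "Y \<in> carrier_mat r c"
      "\<And>i. i < N \<Longrightarrow> i \<noteq> n \<Longrightarrow> row_block rs X i = row_block rs Y i" for X Y
    using notin n that by (auto simp: scope_def)
  have "A $$ (block_offset rs n + u, block_offset rs i + v) = 0" if uv: "u < rs n" "v < rs i" for u v
  proof -
    let ?s = "block_offset rs n + u" and ?t = "block_offset rs i + v"
    have st: "?s < r" "?t < r" using block_offset_add_less n i uv r by auto
    have C: "A \<in> carrier_mat r r" using A by (auto simp: sym_mats_def)
    \<comment> \<open>Adding the unit vector at \<open>?s\<close> alters only block
      \<open>n\<close>, because different blocks occupy disjoint rows.\<close>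
    have shift: "quad_val A (single_column r c (\<lambda>i. of_bool (i = ?s) + x i)) = quad_val A (single_column r c x)" for x
    proof (rule inv)
      fix j assume j: "j < N" "j \<noteq> n"
      have "block_offset rs j + w \<noteq> ?s" if "w < rs j" for w
        using block_offset_add_inj[of w rs j u n] that uv j by auto
      moreover have "block_offset rs j + w < r" if "w < rs j" for w
        using block_offset_add_less[of j N w rs] that j r by simp
      ultimately show "row_block rs (single_column r c (\<lambda>i. of_bool (i = ?s) + x i)) j =
          row_block rs (single_column r c x) j"
        by (auto simp: row_block_def single_column_def intro!: eq_matI)
    qed auto
    \<comment> \<open>The shift of the zero vector removes the term at \<open>?s\<close> in
      \<open>polarization\<close>; the shift of the unit vector at \<open>?t\<close> then cancels
      the other two terms.\<close>
    have "quad_val A (single_column r c (\<lambda>i. of_bool (i = ?s))) = 0"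
      using shift[of "\<lambda>_. 0"] by (simp add: quad_val_single_column[OF C c])
    then show ?thesis
      using polarization[OF A c st] shift[of "\<lambda>i. of_bool (i = ?t)"] by simp
  qed
  then have "mat_block rs A n i = 0\<^sub>m (rs n) (rs i)"
    by (auto simp: mat_block_def intro!: eq_matI)
  with i show False by simp
qed

lemma scope_subset: "scope N rs r c f \<subseteq> {..<N}"
  by (auto simp: scope_def)

lemma scope_cong:
  assumes "\<And>X. X \<in> carrier_mat r c \<Longrightarrow> f X = g X"
  shows "scope N rs r c f = scope N rs r c g"
  unfolding scope_def using assms by (intro Collect_cong) (metis (no_types, lifting))

text \<open>Both scopes are the set of nonzero block rows of \<open>A\<close>, by the column-free
  criterion \<open>mem_scope_quad_val_iff\<close>.\<close>

lemma scope_quad_val_columns: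
  assumes "A \<in> sym_mats r" "0 < c" "0 < p" "r = block_offset rs N"
  shows "scope N rs r c (quad_val A) = scope N rs r p (quad_val A)"
proof -
  have "n < N" if "n \<in> scope N rs r c' f" for n c' f using that by (simp add: scope_def)
  with assms show ?thesis
    by (metis (no_types, lifting) mem_scope_quad_val_iff subsetI subset_antisym)
qed

lemma mat_block_transpose:
  assumes "A \<in> sym_mats r" "r = block_offset rs N" "i < N" "j < N"
  shows "mat_block rs A j i = transpose_mat (mat_block rs A i j)"
proof (rule eq_matI)
  fix u v assume "u < dim_row (transpose_mat (mat_block rs A i j))"
    "v < dim_col (transpose_mat (mat_block rs A i j))"
  then have uv: "u < rs j" "v < rs i" by (auto simp: mat_block_def)
  let ?s = "block_offset rs j + u" and ?t = "block_offset rs i + v"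
  have C: "A \<in> carrier_mat r r" and T: "transpose_mat A = A"
    using assms(1) by (auto simp: sym_mats_def)
  have st: "?s < r" "?t < r" using uv assms block_offset_add_less by auto
  have "transpose_mat A $$ (?s, ?t) = A $$ (?t, ?s)" using C st by simp
  then show "mat_block rs A j i $$ (u, v) = transpose_mat (mat_block rs A i j) $$ (u, v)"
    using uv by (simp add: T mat_block_def)
qed (auto simp: mat_block_def)

text \<open>An index outside the scope kills its block row directly, and its block column by
  transposition.\<close>

lemma mat_block_eq_0_if_notin_scope:
  assumes A: "A \<in> sym_mats r" and c: "0 < c" and r: "r = block_offset rs N" and ij: "i < N" "j < N"
    and notin: "i \<notin> scope N rs r c (quad_val A) \<or> j \<notin> scope N rs r c (quad_val A)"
  shows "mat_block rs A i j = 0\<^sub>m (rs i) (rs j)"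
proof (cases "i \<notin> scope N rs r c (quad_val A)")
  case True
  with ij mem_scope_quad_val_iff[OF A c r ij(1)] show ?thesis by blast
next
  case False
  with notin ij mem_scope_quad_val_iff[OF A c r ij(2)]
  have "mat_block rs A j i = 0\<^sub>m (rs j) (rs i)" by blast
  with mat_block_transpose[OF A r ij(2,1)] show ?thesis by simp
qed

section \<open>Transfer of the objective to another number of columns\<close>

text \<open>The identity on matrices with \<open>c\<close> columns yields the entrywise identity
  \<open>Q = \<Sum>k<K. Qf k\<close>, which can then be evaluated at matrices with \<open>p\<close>
  columns.\<close>

lemma sum_quad_val_columns:
  assumes Q: "Q \<in> sym_mats r" and Qf: "\<And>k. k < K \<Longrightarrow> Qf k \<in> sym_mats r" and c: "0 < c"
    and eq: "\<And>X. X \<in> carrier_mat r c \<Longrightarrow> quad_val Q X = (\<Sum>k<K. quad_val (Qf k) X)"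
    and Y: "Y \<in> carrier_mat r p"
  shows "quad_val Q Y = (\<Sum>k<K. quad_val (Qf k) Y)"
proof -
  have entry: "Q $$ (s, t) = (\<Sum>k<K. Qf k $$ (s, t))" if "s < r" "t < r" for s t
  proof -
    \<comment> \<open>Polarization expresses each entry by the same linear combination of three
      values, so the assumed identity at the three single-column matrices suffices.\<close>
    have "2 * Q $$ (s, t) = (\<Sum>k<K. 2 * Qf k $$ (s, t))"
      using that by (simp add: polarization[OF Q c] polarization[OF Qf c] eq sum_subtractf)
    then show ?thesis by (simp flip: sum_distrib_left)
  qed
  have C: "Q \<in> carrier_mat r r" and Cf: "\<And>k. k < K \<Longrightarrow> Qf k \<in> carrier_mat r r"
    using Q Qf by (auto simp: sym_mats_def)
  let ?g = "\<lambda>s t. \<Sum>u<p. Y $$ (s, u) * Y $$ (t, u)"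
  have "quad_val Q Y = (\<Sum>s<r. \<Sum>t<r. \<Sum>k<K. Qf k $$ (s, t) * ?g s t)"
    by (simp add: quad_val_eq_sum[OF C Y] entry sum_distrib_right)
  also have "\<dots> = (\<Sum>s<r. \<Sum>k<K. \<Sum>t<r. Qf k $$ (s, t) * ?g s t)"
    by (rule sum.cong[OF refl], rule sum.swap)
  also have "\<dots> = (\<Sum>k<K. \<Sum>s<r. \<Sum>t<r. Qf k $$ (s, t) * ?g s t)"
    by (rule sum.swap)
  also have "\<dots> = (\<Sum>k<K. quad_val (Qf k) Y)"
    by (simp add: quad_val_eq_sum[OF Cf Y])
  finally show ?thesis .
qed

section \<open>Separable constraints and product feasible sets\<close>

text \<open>Each constraint is assigned to the one variable in its scope. A constraint with empty
  scope may go to any variable, and \<open>0 < N\<close> provides one.\<close>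

lemma exists_separating_partition:
  assumes A: "\<And>m. m < M \<Longrightarrow> A m \<in> sym_mats r" and c: "0 < c" and r: "r = block_offset rs N"
    and "0 < N" and card: "\<And>m. m < M \<Longrightarrow> card (scope N rs r c (quad_val (A m))) \<le> 1"
  shows "\<exists>L. separating_partition N rs M A L"
proof -
  have "\<exists>n<N. scope N rs r c (quad_val (A m)) \<subseteq> {n}" if "m < M" for m
  proof (cases "scope N rs r c (quad_val (A m)) = {}")
    case True
    then show ?thesis using \<open>0 < N\<close> by auto
  next
    case False
    then obtain n where n: "n \<in> scope N rs r c (quad_val (A m))" by blast
    have "finite (scope N rs r c (quad_val (A m)))"
      by (rule finite_subset[OF scope_subset]) simp
    with card[OF that] n have "scope N rs r c (quad_val (A m)) \<subseteq> {n}"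
      by (simp add: card_le_Suc0_iff_eq) blast
    moreover have "n < N" using n scope_subset by blast
    ultimately show ?thesis by blast
  qed
  then obtain g where g: "\<And>m. m < M \<Longrightarrow> g m < N \<and> scope N rs r c (quad_val (A m)) \<subseteq> {g m}"
    by metis
  \<comment> \<open>The parts are the fibres of the assignment \<open>g\<close>, hence disjoint and
    covering.\<close>
  have "separating_partition N rs M A (\<lambda>n. {m. m < M \<and> g m = n})"
    unfolding separating_partition_def
  proof (intro conjI allI ballI impI)
    fix n m i j
    assume *: "n < N" "m \<in> {m. m < M \<and> g m = n}" "i < N" "j < N" "(i, j) \<noteq> (n, n)"
    then have m: "m < M" and sub: "scope N rs r c (quad_val (A m)) \<subseteq> {n}"
      using g by auto
    have "i \<notin> scope N rs r c (quad_val (A m)) \<or> j \<notin> scope N rs r c (quad_val (A m))"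
      using sub *(5) by auto
    then show "mat_block rs (A m) i j = 0\<^sub>m (rs i) (rs j)"
      by (rule mat_block_eq_0_if_notin_scope[OF A[OF m] c r *(3,4)])
  qed (use g in \<open>auto simp: disjoint_family_on_def\<close>)
  then show ?thesis by blast
qed

lemma quad_val_separated:
  assumes L: "separating_partition N rs M A L" and n: "n < N" "m \<in> L n"
    and A: "A m \<in> carrier_mat r r" and X: "X \<in> carrier_mat r c" and r: "r = block_offset rs N"
  shows "quad_val (A m) X =
    frob (mat_block rs (A m) n n) (row_block rs X n * transpose_mat (row_block rs X n))"
proof -
  have "mat_block rs (A m) i j = 0\<^sub>m (rs i) (rs j)" if "i < N" "j < N" "i \<notin> {n} \<or> j \<notin> {n}" for i j
    using L n that unfolding separating_partition_def by auto
  from quad_val_eq_block_factor[OF A X r _ this, of "{n}"] n(1)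
  show ?thesis by (simp add: block_factor_def)
qed

text \<open>Grouping the constraints by the parts of \<open>L\<close> leaves, for each
  \<open>n\<close>, conditions on block \<open>n\<close> alone. It serves both the original problem
  and its lift.\<close>

lemma feasible_eq_block_product:
  assumes L: "separating_partition N rs M A L"
    and A: "\<And>m. m < M \<Longrightarrow> A m \<in> carrier_mat r r" and r: "r = block_offset rs N"
  shows "qcqp_feasible r c M A b = block_product N rs r c (block_domain rs c A b L)"
proof -
  have U: "(\<Union>n<N. L n) = {..<M}" using L by (simp add: separating_partition_def)
  have "(\<forall>m<M. quad_val (A m) X = b m) \<longleftrightarrow> (\<forall>n<N. row_block rs X n \<in> block_domain rs c A b L n)"
    if X: "X \<in> carrier_mat r c" for X
  proof -
    have "(\<forall>m<M. quad_val (A m) X = b m) \<longleftrightarrow> (\<forall>n<N. \<forall>m\<in>L n. quad_val (A m) X = b m)"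
      using U by blast
    also have "\<dots> \<longleftrightarrow> (\<forall>n<N. row_block rs X n \<in> block_domain rs c A b L n)"
    proof -
      have "m < M" if "n < N" "m \<in> L n" for n m using U that by blast
      then show ?thesis
        using X by (auto simp: block_domain_def quad_val_separated[OF L _ _ A X r])
    qed
    finally show ?thesis .
  qed
  then show ?thesis by (auto simp: qcqp_feasible_def block_product_def)
qed

text \<open>An element of one factor is spliced into a point of the nonempty product; the result
  lies in the larger product, whose \<open>n\<close>-th condition is then read off. Used in both
  directions, it recovers the factors from equal nonempty products.\<close>

lemma block_product_domain_subset:
  assumes D: "\<And>n. n < N \<Longrightarrow> D n \<subseteq> carrier_mat (rs n) c"
    and sub: "block_product N rs r c D \<subseteq> block_product N rs r c D'"
    and ne: "block_product N rs r c D \<noteq> {}" and n: "n < N" and r: "r = block_offset rs N"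
  shows "D n \<subseteq> D' n"
proof
  fix Z assume Z: "Z \<in> D n"
  then have Zc: "Z \<in> carrier_mat (rs n) c" using D n by blast
  obtain X where X: "X \<in> carrier_mat r c" "\<And>i. i < N \<Longrightarrow> row_block rs X i \<in> D i"
    using ne by (auto simp: block_product_def)
  \<comment> \<open>\<open>W\<close> is \<open>X\<close> with the rows of block \<open>n\<close>
    replaced by \<open>Z\<close>.\<close>
  define W where "W = mat r c (\<lambda>(s, t).
    if block_offset rs n \<le> s \<and> s < block_offset rs n + rs n
    then Z $$ (s - block_offset rs n, t) else X $$ (s, t))"
  have less: "block_offset rs i + u < r" if "i < N" "u < rs i" for i u
    using block_offset_add_less that r by blast
  have Wn: "row_block rs W n = Z"
    using Zc less[OF n] by (auto simp: row_block_def W_def intro!: eq_matI)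
  have Wi: "row_block rs W i = row_block rs X i" if i: "i < N" "i \<noteq> n" for i
  proof -
    have "\<not> (block_offset rs n \<le> block_offset rs i + u \<and>
        block_offset rs i + u < block_offset rs n + rs n)" if "u < rs i" for u
      \<comment> \<open>The subtraction is the position inside block \<open>n\<close> that the row
        would have; it is not truncated in the case being refuted.\<close>
      using block_offset_add_inj[of u rs i "block_offset rs i + u - block_offset rs n" n] that i by auto
    then show ?thesis
      using X(1) less[OF i(1)] by (auto simp: row_block_def W_def intro!: eq_matI)
  qed
  have "row_block rs W i \<in> D i" if "i < N" for i
    using X(2)[OF that] Z Wn Wi[OF that] by (cases "i = n") auto
  then have "W \<in> block_product N rs r c D"
    by (simp add: block_product_def W_def)
  then have "row_block rs W n \<in> D' n"
    using sub n by (auto simp: block_product_def)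
  with Wn show "Z \<in> D' n" by simp
qed

text \<open>Equality with the given domains \<open>D n\<close> is claimed for a nonempty feasible
  set, since an empty product does not determine its factors. Existence of a separating partition is
  stated apart, so that the lift holds for each choice of \<open>L\<close>.\<close>

theorem mainTheorem1:
  fixes r d M N K :: nat
    and rs :: "nat \<Rightarrow> nat"
    and Q :: "real mat" and A :: "nat \<Rightarrow> real mat" and b :: "nat \<Rightarrow> real"
    and D :: "nat \<Rightarrow> real mat set"
    and l :: "nat \<Rightarrow> real mat \<Rightarrow> real"
    and Qf :: "nat \<Rightarrow> real mat"
    and S :: "nat \<Rightarrow> nat set"
  assumes "0 < r" "0 < d" "0 < M" "0 < N" "0 < K" "d \<le> r"
    and "Q \<in> sym_mats r"
    and "\<forall>m<M. A m \<in> sym_mats r"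
    and "\<forall>n<N. 0 < rs n"
    and "r = (\<Sum>n<N. rs n)"
    and "factor_graph_model N rs r d M Q A b K D l Qf S"
  shows
    "(\<forall>k<K. \<forall>n<N. n \<notin> S k \<longrightarrow>
        (\<forall>i<N. mat_block rs (Qf k) n i = 0\<^sub>m (rs n) (rs i) \<and>
               mat_block rs (Qf k) i n = 0\<^sub>m (rs i) (rs n))) \<and>
     (\<forall>k<K. \<forall>X\<in>carrier_mat r d. l k X = block_factor rs (Qf k) (S k) (restrict (row_block rs X) (S k))) \<and>
     (\<exists>L. separating_partition N rs M A L) \<and>
     (\<forall>L. separating_partition N rs M A L \<longrightarrow>
        qcqp_feasible r d M A b = block_product N rs r d (block_domain rs d A b L) \<and>
        (qcqp_feasible r d M A b \<noteq> {} \<longrightarrow> (\<forall>n<N. D n = block_domain rs d A b L n)) \<and>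
        (\<forall>p>0.
           let lbar = (\<lambda>k Y. block_factor rs (Qf k) (S k) (restrict (row_block rs Y) (S k))) in
             factor_graph_model N rs r p M Q A b K (block_domain rs p A b L) lbar Qf S \<and>
             qcqp_feasible r p M A b = block_product N rs r p (block_domain rs p A b L) \<and>
             (\<forall>Y\<in>carrier_mat r p. quad_val Q Y = (\<Sum>k<K. lbar k Y)) \<and>
             factor_graph_edges N rs r p K lbar = {(n, k). n < N \<and> k < K \<and> n \<in> S k} \<and>
             factor_graph_edges N rs r p K lbar = factor_graph_edges N rs r d K l))"
proof -
  have r: "r = block_offset rs N" using assms(10) by (simp add: block_offset_def)
  have d: "0 < d" by fact
  have Q: "Q \<in> sym_mats r" by fact
  have A: "A m \<in> sym_mats r" if "m < M" for m using assms(8) that by blast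
  have Ac: "A m \<in> carrier_mat r r" if "m < M" for m using A[OF that] by (simp add: sym_mats_def)
  have obj: "quad_val Q X = (\<Sum>k<K. l k X)" if "X \<in> carrier_mat r d" for X
    using assms(11) that unfolding factor_graph_model_def by blast
  have Qf: "Qf k \<in> sym_mats r" if "k < K" for k
    using assms(11) that unfolding factor_graph_model_def by blast
  have l: "l k X = quad_val (Qf k) X" if "k < K" "X \<in> carrier_mat r d" for k X
    using assms(11) that unfolding factor_graph_model_def by blast
  have Sl: "S k = scope N rs r d (l k)" if "k < K" for k
    using assms(11) that unfolding factor_graph_model_def by blast
  have D: "D n \<subseteq> carrier_mat (rs n) d" if "n < N" for n
    using assms(11) that unfolding factor_graph_model_def by blast
  have feas: "qcqp_feasible r d M A b = block_product N rs r d D"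
    using assms(11) unfolding factor_graph_model_def by blast
  have card: "card (scope N rs r d (quad_val (A m))) \<le> 1" if "m < M" for m
    using assms(11) that unfolding factor_graph_model_def by blast
  \<comment> \<open>\<open>S k\<close> is given as a scope at \<open>d\<close> columns; it is
    rewritten here for an arbitrary positive column count.\<close>
  have S: "S k = scope N rs r c (quad_val (Qf k))" if "k < K" "0 < c" for k c
    using Sl[OF that(1)] scope_cong[OF l[OF that(1)]]
      scope_quad_val_columns[OF Qf[OF that(1)] d that(2) r] by simp
  have zero: "mat_block rs (Qf k) i j = 0\<^sub>m (rs i) (rs j)"
    if "k < K" "i < N" "j < N" "i \<notin> S k \<or> j \<notin> S k" for k i j
    using mat_block_eq_0_if_notin_scope[OF Qf d r] that S[OF that(1) d] by simp
  \<comment> \<open>The column count \<open>c\<close> stays free: \<open>d\<close> yields the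
    formula for \<open>l k\<close>, and \<open>p\<close> identifies the lifted factors with
    quadratic forms.\<close>
  have lbar: "block_factor rs (Qf k) (S k) (restrict (row_block rs Y) (S k)) = quad_val (Qf k) Y"
    if k: "k < K" and Y: "Y \<in> carrier_mat r c" for k Y c
  proof -
    have C: "Qf k \<in> carrier_mat r r" using Qf[OF k] by (simp add: sym_mats_def)
    have "S k \<subseteq> {..<N}" using Sl[OF k] scope_subset by simp
    from quad_val_eq_block_factor[OF C Y r this zero[OF k]] show ?thesis by simp
  qed
  have domain: "block_domain rs c A b L n \<subseteq> carrier_mat (rs n) c" for c L n
    by (auto simp: block_domain_def)
  have domains: "D n = block_domain rs d A b L n"
    if L: "separating_partition N rs M A L" and ne: "qcqp_feasible r d M A b \<noteq> {}" and n: "n < N" for L n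
  proof -
    note eq = feasible_eq_block_product[OF L Ac r, of d b]
    have "D n \<subseteq> block_domain rs d A b L n"
      by (rule block_product_domain_subset[OF D _ _ n r]) (use feas eq ne in simp_all)
    moreover have "block_domain rs d A b L n \<subseteq> D n"
      by (rule block_product_domain_subset[OF domain _ _ n r]) (use feas eq ne in simp_all)
    ultimately show ?thesis by (rule subset_antisym)
  qed
  have lifted: "let lbar = (\<lambda>k Y. block_factor rs (Qf k) (S k) (restrict (row_block rs Y) (S k))) in
      factor_graph_model N rs r p M Q A b K (block_domain rs p A b L) lbar Qf S \<and>
      qcqp_feasible r p M A b = block_product N rs r p (block_domain rs p A b L) \<and>
      (\<forall>Y\<in>carrier_mat r p. quad_val Q Y = (\<Sum>k<K. lbar k Y)) \<and>
      factor_graph_edges N rs r p K lbar = {(n, k). n < N \<and> k < K \<and> n \<in> S k} \<and>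
      factor_graph_edges N rs r p K lbar = factor_graph_edges N rs r d K l"
    if L: "separating_partition N rs M A L" and p: "0 < p" for L p
  proof -
    define f where "f = (\<lambda>k Y. block_factor rs (Qf k) (S k) (restrict (row_block rs Y) (S k)))"
    have f: "f k Y = quad_val (Qf k) Y" if "k < K" "Y \<in> carrier_mat r p" for k Y
      using lbar[OF that] by (simp add: f_def)
    have Sf: "scope N rs r p (f k) = S k" if "k < K" for k
      using scope_cong[OF f[OF that]] S[OF that p] by simp
    have eq: "qcqp_feasible r p M A b = block_product N rs r p (block_domain rs p A b L)"
      by (rule feasible_eq_block_product[OF L Ac r])
    have objf: "quad_val Q Y = (\<Sum>k<K. f k Y)" if Y: "Y \<in> carrier_mat r p" for Y
      using sum_quad_val_columns[OF Q Qf d _ Y, of K] obj l f[OF _ Y] by simp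
    \<comment> \<open>The uncoupledness of the constraints is also a scope condition, so it carries
      over from \<open>d\<close> to \<open>p\<close> columns.\<close>
    have "card (scope N rs r p (quad_val (A m))) \<le> 1" if "m < M" for m
      using card[OF that] scope_quad_val_columns[OF A[OF that] d p r] by simp
    then have "factor_graph_model N rs r p M Q A b K (block_domain rs p A b L) f Qf S"
      unfolding factor_graph_model_def using objf Qf f Sf domain eq by auto
    moreover have "factor_graph_edges N rs r p K f = {(n, k). n < N \<and> k < K \<and> n \<in> S k}"
      "factor_graph_edges N rs r d K l = {(n, k). n < N \<and> k < K \<and> n \<in> S k}"
      using Sf Sl by (auto simp: factor_graph_edges_def)
    ultimately show ?thesis
      using eq objf unfolding Let_def f_def[symmetric] by blast
  qed
  show ?thesis
    using zero l lbar exists_separating_partition[OF A d r assms(4) card]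
      feasible_eq_block_product[OF _ Ac r] domains lifted
    by (intro conjI) (simp_all del: Let_def)
qed

end
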